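(* Suppose $(\mathfrak X,\mathcal V^* )$, with surjective summary maps $\{\sigma_t\}_{t=0}^{T+1}$, factorizes a compatible utility system $\mathbf U$ for the grand preference $\mathcal P$, and that the feasibility correspondences satisfy Markov feasibility and DP regularity (defined in the context). Then the optimal PA value functions $J_t^*(x_t)=\sup_{\pi\in\Pi}U_t^{*\pi}(x_t)$, $t\in[T]$, satisfy $$J_T^*(x_T)=\max_{c\in\mathcal A_T(x_T)}U_{T+1}^*(\Gamma_T(x_T,c,\star)),\quad\forall x_T\in\mathcal X_T,$$ $$J_t^*(x_t)=\max_{c\in\mathcal A_t(x_t)}W_t^*\bigl(x_t,c,M_t^*(x_t,\tilde j^*_{t+1}(x_t,c))\bigr),\quad\forall x_t\in\mathcal X_t,\ t\in[T-1],$$ where $\tilde j^*_{t+1}(x_t,c)\in\mathcal L$ is given by $[\tilde j^*_{t+1}(x_t,c)](s)=J^*_{t+1}(\Gamma_t(x_t,c,s))$ for $s\in\mathcal S$. The maxima are attained. There exists a single $\bar\pi\in\Pi$ which attains the displayed maxima at every state and time, and satisfies $U_t^{*\bar\pi}(x_t)=J_t^*(x_t)$ for every $x_t\in\mathcal X_t$ and $t\in[T]$. Moreover, each $J_t^*$ is continuous.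
   Context: **Primitives.** For an integer $n\ge 0$, $[n]=\{0,1,\dots,n\}$. $T\ge 1$ is an integer horizon. $\mathcal S$ is a finite nonempty set (discrete topology); $\mathcal S_0=\{\bar s_0\}$ is a singleton, $\mathcal S_t=\mathcal S$ for $1\le t\le T$, $\mathcal S_{T+1}=\{\star\}$. $\mathcal C=[0,\bar c]\subset\mathbb R_{\ge 0}$ is a compact interval. Histories: $\mathcal H_0=\{\bar s_0\}$, $\mathcal H_t=\mathcal H_{t-1}\times\mathcal C\times\mathcal S_t$ for $1\le t\le T$, $\mathcal H_{T+1}=\mathcal H_T\times\mathcal C$, with product topologies (compact metrizable). Extension maps $\iota_t:\mathcal H_t\times\mathcal C\times\mathcal S_{t+1}\to\mathcal H_{t+1}$: $\iota_t(h_t,c,s)=(h_t,c,s)$ for $t\in[T-1]$, $\iota_T(h_T,c,\star)=(h_T,c)$. Physical-state projections $\sigma^s_t:\mathcal H_t\to\mathcal S_t$: $\sigma_t^s(h_t)$ is the last state $s_t$ of $h_t$ for $t\in[T]$, and $\sigma^s_{T+1}\equiv\star$. Plans: $\mathcal F_{T+1}=\{\emptyset\}$ and $\mathcal F_t=\mathcal C\times(\mathcal F_{t+1})^{\mathcal S}$ for $t\in[T]$ (product topology); $\mathcal F_T$ is identified with $\mathcal C$. For $t\in[T-1]$ a plan is written $f=(c,f_+)$ with $c\in\mathcal C$, $f_+:\mathcal S\to\mathcal F_{t+1}$. $\mathcal L=\mathbb R^{\mathcal S}$ with sup norm and pointwise order; $\mathbf v\in\mathcal L$ is the constant vector with value $v$.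 **Preferences.** A grand preference is $\mathcal P=(\{\succeq_{(t)}\}_{t=0}^T,V_{T+1})$ with $\succeq_{(t)}$ a binary relation on $\mathcal H_t\times\mathcal F_t$ and $V_{T+1}:\mathcal H_{T+1}\to\mathbb R$ continuous. A utility system is $\mathbf U=\{U_t\}_{t=0}^{T+1}$ with $U_t:\mathcal H_t\times\mathcal F_t\to\mathbb R$ ($t\in[T]$) and $U_{T+1}:\mathcal H_{T+1}\to\mathbb R$ continuous. It is compatible with $\mathcal P$ if $U_{T+1}=V_{T+1}$; $U_T(h_T,c)=U_{T+1}(\iota_T(h_T,c,\star))$; and for all $t\in[T]$, $U_t(h_t,f)\ge U_t(h_t',g)\iff(h_t,f)\succeq_{(t)}(h_t',g)$. **PA-state systems.** A PA-state system is $\mathfrak X=(\{\mathcal X_t\}_{t=0}^{T+1},\{\varsigma_t\}_{t=0}^{T+1},\{\Gamma_t\}_{t=0}^{T})$ with $\mathcal X_t$ nonempty compact metrizable, $\varsigma_t:\mathcal X_t\to\mathcal S_t$ continuous, and $\Gamma_t:\mathcal X_t\times\mathcal C\times\mathcal S_{t+1}\to\mathcal X_{t+1}$ continuous with $\varsigma_{t+1}(\Gamma_t(x,c,s'))=s'$. A PA recursive structure on $\mathfrak X$ is $\mathcal V^*=(\{W_t^*\}_{t=0}^{T-1},\{M_t^*\}_{t=0}^{T-1},V_{T+1}^* )$ where $W_t^*:\mathcal X_t\times\mathcal C\times\mathbb R\to\mathbb R$ is jointly continuous and nondecreasing in its last argument; $M_t^*:\mathcal X_t\times\mathcal L\to\mathbb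 R$ is jointly continuous, monotone in $\tilde u\in\mathcal L$, and $M_t^*(x,\mathbf v)=v$ for all $x$, $v\in\mathbb R$; $V_{T+1}^*:\mathcal X_{T+1}\to\mathbb R$ is continuous. $(\mathfrak X,\mathcal V^* )$ generates $\{U_t^*\}$: $U_{T+1}^*=V_{T+1}^*$, $U_T^*(x_T,c)=U_{T+1}^*(\Gamma_T(x_T,c,\star))$, and for $t\in[T-1]$, $f=(c,f_+)$, $U_t^*(x_t,f)=W_t^*(x_t,c,M_t^*(x_t,\tilde u^*_{t+1}(x_t,f)))$ with $[\tilde u^*_{t+1}(x_t,f)](s)=U_{t+1}^*(\Gamma_t(x_t,c,s),f_+(s))$. **Factorization.** $(\mathfrak X,\mathcal V^* )$ with continuous summary maps $\sigma_t:\mathcal H_t\to\mathcal X_t$ factorizes $\mathbf U$ if $\varsigma_t\circ\sigma_t=\sigma_t^s$ ($t\in[T+1]$), $U_{T+1}=U_{T+1}^*\circ\sigma_{T+1}$, $U_t(h_t,f)=U_t^*(\sigma_t(h_t),f)$ for all $h_t,f$, $t\in[T]$, and $\sigma_{t+1}(\iota_t(h_t,c,s))=\Gamma_t(\sigma_t(h_t),c,s)$ for all $h_t,c,s\in\mathcal S_{t+1}$, $t\in[T]$. **Feasibility and policies.** For $t\in[T]$, $\mathcal A_t:\mathcal H_t\rightrightarrows\mathcal C$ is the correspondence of feasible consumption levels. Markov feasibility: if $\sigma_t(h_t)=\sigma_t(h_t')$ then $\mathcal A_t(h_t)=\mathcal A_t(h_t')$; one then writes $\mathcal A_t(x_t)=\mathcal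 A_t(h_t)$ for any $h_t\in\sigma_t^{-1}(x_t)$. DP regularity: for all $t\in[T]$, $\mathcal A_t:\mathcal X_t\rightrightarrows\mathcal C$ is continuous (upper and lower hemicontinuous) with nonempty compact values. $\Pi$ is the set of all PA Markov policies $\pi=\{\pi_t\}_{t=0}^T$, i.e. arbitrary functions $\pi_t:\mathcal X_t\to\mathcal C$ with $\pi_t(x_t)\in\mathcal A_t(x_t)$. Policy utilities: $U_{T+1}^{*\pi}=U_{T+1}^*$, $U_T^{*\pi}(x_T)=U_{T+1}^{*\pi}(\Gamma_T(x_T,\pi_T(x_T),\star))$, and for $t\in[T-1]$, $U_t^{*\pi}(x_t)=W_t^*(x_t,\pi_t(x_t),M_t^*(x_t,\tilde u_{t+1}^{*\pi}(x_t,\pi_t(x_t))))$ with $[\tilde u_{t+1}^{*\pi}(x_t,c)](s)=U_{t+1}^{*\pi}(\Gamma_t(x_t,c,s))$ for $s\in\mathcal S$. *)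

theory Defs
  imports "HOL-Analysis.Analysis"
begin

section \<open>Primitives\<close>

text \<open>All physical states, including the initial state and the terminal symbol, live in one type
  \<open>'s\<close>; no relation between \<open>init_state\<close>, \<open>terminal\<close> and \<open>states\<close> is imposed.\<close>

record 's primitives =
  horizon :: nat
  states :: "'s set"
  init_state :: 's
  terminal :: 's
  max_cons :: real

definition primitives_ok :: "'s primitives \<Rightarrow> bool" where
  "primitives_ok E \<longleftrightarrow>
     1 \<le> horizon E \<and> finite (states E) \<and> states E \<noteq> {} \<and> 0 \<le> max_cons E"

definition state_set :: "'s primitives \<Rightarrow> nat \<Rightarrow> 's set" where
  "state_set E t =
     (if t = 0 then {init_state E} else if t \<le> horizon E then states E else {terminal E})"

definition cons_set :: "'s primitives \<Rightarrow> real set" where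
  "cons_set E = {0..max_cons E}"

abbreviation cons_space :: "'s primitives \<Rightarrow> real topology" where
  "cons_space E \<equiv> top_of_set (cons_set E)"

abbreviation state_space :: "'s primitives \<Rightarrow> nat \<Rightarrow> 's topology" where
  "state_space E t \<equiv> discrete_topology (state_set E t)"

text \<open>\<open>\<real>\<^sup>S\<close> with the topology of the sup norm; its points are extensional functions.\<close>

definition payoff_space :: "'s primitives \<Rightarrow> ('s \<Rightarrow> real) topology" where
  "payoff_space E = mtopology_of (funspace (states E) euclidean_metric)"

lemma topspace_payoff_space:
  assumes "finite (states E)"
  shows "topspace (payoff_space E) = (states E \<rightarrow>\<^sub>E UNIV)"
  using assms
  by (auto simp: payoff_space_def Metric_space.fspace_def[OF Met_TC.Metric_space_axioms] PiE_def
      intro!: finite_imp_bounded)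


section \<open>Histories\<close>

text \<open>\<open>Step h c s\<close> is the history \<open>(h, c, s)\<close>; \<open>Stop h c\<close> is a terminal
  history \<open>(h, c)\<close>.\<close>

datatype 's history =
    Start 's
  | Step "'s history" real 's
  | Stop "'s history" real

fun step_parts :: "'s history \<Rightarrow> 's history \<times> real \<times> 's" where
  "step_parts (Step h c s) = (h, c, s)"
| "step_parts _ = undefined"

fun stop_parts :: "'s history \<Rightarrow> 's history \<times> real" where
  "stop_parts (Stop h c) = (h, c)"
| "stop_parts _ = undefined"

text \<open>The pullbacks below transport the product topologies along the bijections
  \<open>Step h c s \<mapsto> (h, c, s)\<close> and \<open>Stop h c \<mapsto> (h, c)\<close>. Only the indices up to
  \<open>horizon E + 1\<close> are meaningful.\<close>

primrec hist_space :: "'s primitives \<Rightarrow> nat \<Rightarrow> 's history topology" where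
  "hist_space E 0 = discrete_topology {Start (init_state E)}"
| "hist_space E (Suc t) =
     (if t < horizon E
      then pullback_topology {Step h c s | h c s. True} step_parts
             (prod_topology (hist_space E t)
               (prod_topology (cons_space E) (state_space E (Suc t))))
      else pullback_topology {Stop h c | h c. True} stop_parts
             (prod_topology (hist_space E t) (cons_space E)))"

abbreviation hist_set :: "'s primitives \<Rightarrow> nat \<Rightarrow> 's history set" where
  "hist_set E t \<equiv> topspace (hist_space E t)"

definition extend_hist :: "'s primitives \<Rightarrow> nat \<Rightarrow> 's history \<Rightarrow> real \<Rightarrow> 's \<Rightarrow> 's history" where
  "extend_hist E t h c s = (if t < horizon E then Step h c s else Stop h c)"

fun last_state :: "'s history \<Rightarrow> 's" where
  "last_state (Start s) = s"
| "last_state (Step h c s) = s"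
| "last_state (Stop h c) = last_state h"

definition phys_state :: "'s primitives \<Rightarrow> nat \<Rightarrow> 's history \<Rightarrow> 's" where
  "phys_state E t h = (if t \<le> horizon E then last_state h else terminal E)"

lemma hist_set_0: "hist_set E 0 = {Start (init_state E)}"
  by simp

lemma hist_set_Suc:
  "hist_set E (Suc t) =
     (if t < horizon E
      then {Step h c s | h c s. h \<in> hist_set E t \<and> c \<in> cons_set E \<and> s \<in> state_set E (Suc t)}
      else {Stop h c | h c. h \<in> hist_set E t \<and> c \<in> cons_set E})"
  by (auto simp: topspace_pullback_topology)


section \<open>Plans\<close>

datatype 's plan =
    Null
  | Plan (now: real) (later: "'s \<Rightarrow> 's plan")

text \<open>\<open>plan_space_aux E n\<close> is the space of plans with \<open>n\<close> remaining consumption dates.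
  Continuations are extensional functions on \<open>states E\<close>, so that at the last date
  \<open>Plan c (\<lambda>s\<in>states E. Null)\<close> is identified with \<open>c\<close>.\<close>

primrec plan_space_aux :: "'s primitives \<Rightarrow> nat \<Rightarrow> 's plan topology" where
  "plan_space_aux E 0 = discrete_topology {Null}"
| "plan_space_aux E (Suc n) =
     pullback_topology {Plan c g | c g. True} (\<lambda>f. (now f, later f))
       (prod_topology (cons_space E) (product_topology (\<lambda>_. plan_space_aux E n) (states E)))"

definition plan_space :: "'s primitives \<Rightarrow> nat \<Rightarrow> 's plan topology" where
  "plan_space E t = plan_space_aux E (Suc (horizon E) - t)"

abbreviation plan_set :: "'s primitives \<Rightarrow> nat \<Rightarrow> 's plan set" where
  "plan_set E t \<equiv> topspace (plan_space E t)"

lemma plan_set_terminal: "plan_set E (Suc (horizon E)) = {Null}"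
  by (simp add: plan_space_def)

lemma plan_set_rec:
  assumes "t \<le> horizon E"
  shows "plan_set E t =
           {Plan c g | c g. c \<in> cons_set E \<and> g \<in> states E \<rightarrow>\<^sub>E plan_set E (Suc t)}"
  using assms by (auto simp: plan_space_def Suc_diff_le topspace_pullback_topology)


section \<open>Preferences and utility systems\<close>

record 's preference =
  weak_pref :: "nat \<Rightarrow> ('s history \<times> 's plan) rel"
  pref_end :: "'s history \<Rightarrow> real"

definition grand_preference :: "'s primitives \<Rightarrow> 's preference \<Rightarrow> bool" where
  "grand_preference E P \<longleftrightarrow>
     (\<forall>t\<le>horizon E.
        weak_pref P t \<subseteq> (hist_set E t \<times> plan_set E t) \<times> (hist_set E t \<times> plan_set E t)) \<and>
     continuous_map (hist_space E (Suc (horizon E))) euclideanreal (pref_end P)"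

text \<open>\<open>util U t\<close> is the date-\<open>t\<close> utility for \<open>t \<le> horizon E\<close>, and \<open>util_end U\<close> the utility at
  date \<open>horizon E + 1\<close>. The type parameter \<open>'h\<close> is instantiated by histories and by
  preference-augmented states.\<close>

record ('h, 's) utilities =
  util :: "nat \<Rightarrow> 'h \<Rightarrow> 's plan \<Rightarrow> real"
  util_end :: "'h \<Rightarrow> real"

definition utility_system :: "'s primitives \<Rightarrow> ('s history, 's) utilities \<Rightarrow> bool" where
  "utility_system E U \<longleftrightarrow>
     (\<forall>t\<le>horizon E.
        continuous_map (prod_topology (hist_space E t) (plan_space E t)) euclideanreal
          (\<lambda>(h, f). util U t h f)) \<and>
     continuous_map (hist_space E (Suc (horizon E))) euclideanreal (util_end U)"

definition compatible :: "'s primitives \<Rightarrow> ('s history, 's) utilities \<Rightarrow> 's preference \<Rightarrow> bool" where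
  "compatible E U P \<longleftrightarrow>
     (\<forall>h\<in>hist_set E (Suc (horizon E)). util_end U h = pref_end P h) \<and>
     (\<forall>h\<in>hist_set E (horizon E). \<forall>f\<in>plan_set E (horizon E).
        util U (horizon E) h f = util_end U (extend_hist E (horizon E) h (now f) (terminal E))) \<and>
     (\<forall>t\<le>horizon E. \<forall>h\<in>hist_set E t. \<forall>h'\<in>hist_set E t. \<forall>f\<in>plan_set E t. \<forall>g\<in>plan_set E t.
        util U t h f \<ge> util U t h' g \<longleftrightarrow> ((h, f), (h', g)) \<in> weak_pref P t)"


section \<open>PA-state systems and PA recursive structures\<close>

record ('x, 's) pa_system =
  pa_space :: "nat \<Rightarrow> 'x topology"
  pa_proj :: "nat \<Rightarrow> 'x \<Rightarrow> 's"
  pa_trans :: "nat \<Rightarrow> 'x \<Rightarrow> real \<Rightarrow> 's \<Rightarrow> 'x"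

abbreviation pa_set :: "('x, 's) pa_system \<Rightarrow> nat \<Rightarrow> 'x set" where
  "pa_set X t \<equiv> topspace (pa_space X t)"

definition pa_state_system :: "'s primitives \<Rightarrow> ('x, 's) pa_system \<Rightarrow> bool" where
  "pa_state_system E X \<longleftrightarrow>
     (\<forall>t\<le>Suc (horizon E).
        pa_set X t \<noteq> {} \<and> compact_space (pa_space X t) \<and> metrizable_space (pa_space X t) \<and>
        continuous_map (pa_space X t) (state_space E t) (pa_proj X t)) \<and>
     (\<forall>t\<le>horizon E.
        continuous_map
          (prod_topology (pa_space X t) (prod_topology (cons_space E) (state_space E (Suc t))))
          (pa_space X (Suc t)) (\<lambda>(x, c, s). pa_trans X t x c s) \<and>
        (\<forall>x\<in>pa_set X t. \<forall>c\<in>cons_set E. \<forall>s\<in>state_set E (Suc t).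
           pa_proj X (Suc t) (pa_trans X t x c s) = s))"

record ('x, 's) pa_structure =
  aggregator :: "nat \<Rightarrow> 'x \<Rightarrow> real \<Rightarrow> real \<Rightarrow> real"
  cert_equiv :: "nat \<Rightarrow> 'x \<Rightarrow> ('s \<Rightarrow> real) \<Rightarrow> real"
  pa_end :: "'x \<Rightarrow> real"

definition pa_recursive_structure ::
  "'s primitives \<Rightarrow> ('x, 's) pa_system \<Rightarrow> ('x, 's) pa_structure \<Rightarrow> bool" where
  "pa_recursive_structure E X V \<longleftrightarrow>
     (\<forall>t<horizon E.
        continuous_map
          (prod_topology (pa_space X t) (prod_topology (cons_space E) euclideanreal)) euclideanreal
          (\<lambda>(x, c, v). aggregator V t x c v) \<and>
        (\<forall>x\<in>pa_set X t. \<forall>c\<in>cons_set E. mono (aggregator V t x c)) \<and>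
        continuous_map (prod_topology (pa_space X t) (payoff_space E)) euclideanreal
          (\<lambda>(x, u). cert_equiv V t x u) \<and>
        (\<forall>x\<in>pa_set X t. \<forall>u\<in>topspace (payoff_space E). \<forall>u'\<in>topspace (payoff_space E).
           (\<forall>s\<in>states E. u s \<le> u' s) \<longrightarrow> cert_equiv V t x u \<le> cert_equiv V t x u') \<and>
        (\<forall>x\<in>pa_set X t. \<forall>v. cert_equiv V t x (\<lambda>s\<in>states E. v) = v)) \<and>
     continuous_map (pa_space X (Suc (horizon E))) euclideanreal (pa_end V)"

primrec pa_util ::
  "'s primitives \<Rightarrow> ('x, 's) pa_system \<Rightarrow> ('x, 's) pa_structure \<Rightarrow>
   's plan \<Rightarrow> nat \<Rightarrow> 'x \<Rightarrow> real" where
  "pa_util E X V Null = undefined"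
| "pa_util E X V (Plan c g) = (\<lambda>t x.
     if t < horizon E
     then aggregator V t x c
            (cert_equiv V t x
              (\<lambda>s\<in>states E. pa_util E X V (g s) (Suc t) (pa_trans X t x c s)))
     else pa_end V (pa_trans X t x c (terminal E)))"

definition generated ::
  "'s primitives \<Rightarrow> ('x, 's) pa_system \<Rightarrow> ('x, 's) pa_structure \<Rightarrow> ('x, 's) utilities" where
  "generated E X V = \<lparr>util = (\<lambda>t x f. pa_util E X V f t x), util_end = pa_end V\<rparr>"

definition factorizes ::
  "'s primitives \<Rightarrow> ('x, 's) pa_system \<Rightarrow> ('x, 's) pa_structure \<Rightarrow>
   (nat \<Rightarrow> 's history \<Rightarrow> 'x) \<Rightarrow> ('s history, 's) utilities \<Rightarrow> bool" where
  "factorizes E X V \<sigma> U \<longleftrightarrow>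
     (\<forall>t\<le>Suc (horizon E).
        continuous_map (hist_space E t) (pa_space X t) (\<sigma> t) \<and>
        (\<forall>h\<in>hist_set E t. pa_proj X t (\<sigma> t h) = phys_state E t h)) \<and>
     (\<forall>h\<in>hist_set E (Suc (horizon E)).
        util_end U h = util_end (generated E X V) (\<sigma> (Suc (horizon E)) h)) \<and>
     (\<forall>t\<le>horizon E. \<forall>h\<in>hist_set E t.
        (\<forall>f\<in>plan_set E t. util U t h f = util (generated E X V) t (\<sigma> t h) f) \<and>
        (\<forall>c\<in>cons_set E. \<forall>s\<in>state_set E (Suc t).
           \<sigma> (Suc t) (extend_hist E t h c s) = pa_trans X t (\<sigma> t h) c s))"


section \<open>Feasibility and policies\<close>

definition feasibility_correspondence ::
  "'s primitives \<Rightarrow> (nat \<Rightarrow> 's history \<Rightarrow> real set) \<Rightarrow> bool" where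
  "feasibility_correspondence E A \<longleftrightarrow>
     (\<forall>t\<le>horizon E. \<forall>h\<in>hist_set E t. A t h \<subseteq> cons_set E)"

definition markov_feasibility ::
  "'s primitives \<Rightarrow> (nat \<Rightarrow> 's history \<Rightarrow> 'x) \<Rightarrow> (nat \<Rightarrow> 's history \<Rightarrow> real set) \<Rightarrow> bool" where
  "markov_feasibility E \<sigma> A \<longleftrightarrow>
     (\<forall>t\<le>horizon E. \<forall>h\<in>hist_set E t. \<forall>h'\<in>hist_set E t. \<sigma> t h = \<sigma> t h' \<longrightarrow> A t h = A t h')"

text \<open>Independent of the chosen history under Markov feasibility.\<close>

definition pa_feasible ::
  "'s primitives \<Rightarrow> (nat \<Rightarrow> 's history \<Rightarrow> 'x) \<Rightarrow> (nat \<Rightarrow> 's history \<Rightarrow> real set) \<Rightarrow>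
   nat \<Rightarrow> 'x \<Rightarrow> real set" where
  "pa_feasible E \<sigma> A t x = A t (SOME h. h \<in> hist_set E t \<and> \<sigma> t h = x)"

definition upper_hemicontinuous_map :: "'a topology \<Rightarrow> 'b topology \<Rightarrow> ('a \<Rightarrow> 'b set) \<Rightarrow> bool" where
  "upper_hemicontinuous_map X Y F \<longleftrightarrow>
     (\<forall>x\<in>topspace X. F x \<subseteq> topspace Y) \<and>
     (\<forall>G. openin Y G \<longrightarrow> openin X {x \<in> topspace X. F x \<subseteq> G})"

definition lower_hemicontinuous_map :: "'a topology \<Rightarrow> 'b topology \<Rightarrow> ('a \<Rightarrow> 'b set) \<Rightarrow> bool" where
  "lower_hemicontinuous_map X Y F \<longleftrightarrow>
     (\<forall>x\<in>topspace X. F x \<subseteq> topspace Y) \<and>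
     (\<forall>G. openin Y G \<longrightarrow> openin X {x \<in> topspace X. F x \<inter> G \<noteq> {}})"

definition dp_regularity ::
  "'s primitives \<Rightarrow> ('x, 's) pa_system \<Rightarrow> (nat \<Rightarrow> 'x \<Rightarrow> real set) \<Rightarrow> bool" where
  "dp_regularity E X B \<longleftrightarrow>
     (\<forall>t\<le>horizon E.
        upper_hemicontinuous_map (pa_space X t) (cons_space E) (B t) \<and>
        lower_hemicontinuous_map (pa_space X t) (cons_space E) (B t) \<and>
        (\<forall>x\<in>pa_set X t. B t x \<noteq> {} \<and> compact (B t x)))"

definition policies ::
  "'s primitives \<Rightarrow> ('x, 's) pa_system \<Rightarrow> (nat \<Rightarrow> 'x \<Rightarrow> real set) \<Rightarrow> (nat \<Rightarrow> 'x \<Rightarrow> real) set" where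
  "policies E X B = {\<pi>. \<forall>t\<le>horizon E. \<forall>x\<in>pa_set X t. \<pi> t x \<in> B t x}"

function policy_util ::
  "'s primitives \<Rightarrow> ('x, 's) pa_system \<Rightarrow> ('x, 's) pa_structure \<Rightarrow> (nat \<Rightarrow> 'x \<Rightarrow> real) \<Rightarrow>
   nat \<Rightarrow> 'x \<Rightarrow> real" where
  "policy_util E X V \<pi> t x =
     (if t < horizon E
      then aggregator V t x (\<pi> t x)
             (cert_equiv V t x
               (\<lambda>s\<in>states E. policy_util E X V \<pi> (Suc t) (pa_trans X t x (\<pi> t x) s)))
      else if t = horizon E
      then policy_util E X V \<pi> (Suc t) (pa_trans X t x (\<pi> t x) (terminal E))
      else util_end (generated E X V) x)"
  by auto
termination
  by (relation "Wellfounded.measure (\<lambda>(E, X, V, \<pi>, t, x). Suc (horizon E) - t)") auto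

declare policy_util.simps [simp del]

definition value_fun ::
  "'s primitives \<Rightarrow> ('x, 's) pa_system \<Rightarrow> ('x, 's) pa_structure \<Rightarrow> (nat \<Rightarrow> 'x \<Rightarrow> real set) \<Rightarrow>
   nat \<Rightarrow> 'x \<Rightarrow> real" where
  "value_fun E X V B t x = (SUP \<pi>\<in>policies E X B. policy_util E X V \<pi> t x)"

definition is_maximum :: "real \<Rightarrow> real set \<Rightarrow> bool" where
  "is_maximum m R \<longleftrightarrow> m \<in> R \<and> (\<forall>r\<in>R. r \<le> m)"

end

theory Submission
  imports Defs
begin

text \<open>Backward induction on dates. The Bellman recursion preserves continuity by Berge's maximum
  theorem, so at every date and state the maximum over the compact feasible set is attained.
  Monotonicity of the aggregators and certainty equivalents makes the Bellman value an upper bound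
  for the utility of every policy, while the policy that picks a maximizer at every state attains
  this bound. Hence the Bellman value is the supremum over policies.\<close>

section \<open>Topological tools: compact maxima, Berge's theorem, maps into the payoff
  space\<close>

lemma attains_max_on_compact:
  assumes K: "compactin Y K" "K \<noteq> {}" and f: "continuous_map Y euclideanreal f"
  obtains c where "c \<in> K" "\<And>y. y \<in> K \<Longrightarrow> f y \<le> f c"
proof -
  have "compact (f ` K)"
    using image_compactin[OF K(1) f] by simp
  then show thesis
    using compact_attains_sup[of "f ` K"] K(2) that by fastforce
qed

text \<open>Continuity of \<open>v\<close> splits into openness of its strict superlevel and
  sublevel sets. Lower hemicontinuity keeps a good choice available nearby, which settles the
  former; upper hemicontinuity and compactness, through the tube lemma, settle the latter.\<close>

lemma Berge_maximum:
  fixes f :: "'a \<Rightarrow> 'b \<Rightarrow> real"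
  assumes f: "continuous_map (prod_topology X Y) euclideanreal (\<lambda>(x, y). f x y)"
    and upper: "upper_hemicontinuous_map X Y F"
    and lower: "lower_hemicontinuous_map X Y F"
    and cpt: "\<And>x. x \<in> topspace X \<Longrightarrow> compactin Y (F x)"
    and v: "\<And>x. x \<in> topspace X \<Longrightarrow> is_maximum (v x) (f x ` F x)"
  shows "continuous_map X euclideanreal v"
proof -
  have sub: "F x \<subseteq> topspace Y" if "x \<in> topspace X" for x
    using cpt[OF that] by (rule compactin_subset_topspace)
  let ?gt = "\<lambda>a. {p \<in> topspace (prod_topology X Y). a < (case p of (x, y) \<Rightarrow> f x y)}"
  let ?lt = "\<lambda>a. {p \<in> topspace (prod_topology X Y). (case p of (x, y) \<Rightarrow> f x y) < a}"
  have open_gt: "openin (prod_topology X Y) (?gt a)"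
    and open_lt: "openin (prod_topology X Y) (?lt a)" for a
    using f unfolding continuous_map_upper_lower_semicontinuous_lt by blast+
  have gt_iff: "a < v x \<longleftrightarrow> (\<exists>y\<in>F x. a < f x y)" if "x \<in> topspace X" for a x
    using v[OF that] by (force simp: is_maximum_def)
  \<comment> \<open>Pointwise strict bounds give a strict bound on \<open>v x\<close> because the
    maximum is itself a value of \<open>f x\<close> on \<open>F x\<close>.\<close>
  have lt_iff: "v x < a \<longleftrightarrow> (\<forall>y\<in>F x. f x y < a)" if "x \<in> topspace X" for a x
    using v[OF that] by (force simp: is_maximum_def)
  have "openin X {x \<in> topspace X. a < v x}" for a
  proof (subst openin_subopen, intro ballI)
    fix x0 assume "x0 \<in> {x \<in> topspace X. a < v x}"
    then obtain y0 where x0: "x0 \<in> topspace X" and y0: "y0 \<in> F x0" "a < f x0 y0"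
      using gt_iff by auto
    have "(x0, y0) \<in> ?gt a"
      using x0 y0 sub by auto
    then have "\<exists>G H. openin X G \<and> openin Y H \<and> x0 \<in> G \<and> y0 \<in> H \<and> G \<times> H \<subseteq> ?gt a"
      using iffD1[OF openin_prod_topology_alt open_gt[of a]] by blast
    then obtain G H
      where GH: "openin X G" "openin Y H" "x0 \<in> G" "y0 \<in> H" "G \<times> H \<subseteq> ?gt a"
      by blast
    \<comment> \<open>For \<open>x\<close> in \<open>?N\<close> some point of \<open>F x\<close>
      lies in \<open>H\<close>, and the rectangle \<open>G \<times> H\<close> puts its value above
      \<open>a\<close>.\<close>
    let ?N = "G \<inter> {x \<in> topspace X. F x \<inter> H \<noteq> {}}"
    have "openin X ?N"
      using GH lower by (auto simp: lower_hemicontinuous_map_def)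
    moreover have "x0 \<in> ?N"
      using GH x0 y0 by auto
    moreover have "?N \<subseteq> {x \<in> topspace X. a < v x}"
      using GH(5) gt_iff by fastforce
    ultimately show "\<exists>N. openin X N \<and> x0 \<in> N \<and> N \<subseteq> {x \<in> topspace X. a < v x}"
      by blast
  qed
  moreover have "openin X {x \<in> topspace X. v x < a}" for a
  proof (subst openin_subopen, intro ballI)
    fix x0 assume "x0 \<in> {x \<in> topspace X. v x < a}"
    then have x0: "x0 \<in> topspace X" and lt: "\<forall>y\<in>F x0. f x0 y < a"
      using lt_iff by auto
    have "{x0} \<times> F x0 \<subseteq> ?lt a"
      using x0 lt sub by auto
    \<comment> \<open>Tube lemma: the product of the compact sets \<open>{x0}\<close> and
      \<open>F x0\<close> lies in an open set, so an open rectangle fits in between.\<close>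
    then obtain G H
      where GH: "openin X G" "openin Y H" "{x0} \<subseteq> G" "F x0 \<subseteq> H" "G \<times> H \<subseteq> ?lt a"
      using Wallace_theorem_prod_topology[of X "{x0}" Y "F x0" "?lt a"] open_lt[of a] cpt[OF x0] x0
      by auto
    let ?N = "G \<inter> {x \<in> topspace X. F x \<subseteq> H}"
    have "openin X ?N"
      using GH upper by (auto simp: upper_hemicontinuous_map_def)
    moreover have "x0 \<in> ?N"
      using GH x0 by auto
    moreover have "?N \<subseteq> {x \<in> topspace X. v x < a}"
      using GH(5) lt_iff by fastforce
    ultimately show "\<exists>N. openin X N \<and> x0 \<in> N \<and> N \<subseteq> {x \<in> topspace X. v x < a}"
      by blast
  qed
  ultimately show ?thesis
    unfolding continuous_map_upper_lower_semicontinuous_lt by blast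
qed

text \<open>On finitely many states the sup metric is controlled coordinate by coordinate:
  intersecting one neighbourhood per state makes all coordinates close at once.\<close>

lemma continuous_map_payoff_space:
  assumes fin: "finite (states E)" and ne: "states E \<noteq> {}"
    and g: "\<And>s. s \<in> states E \<Longrightarrow> continuous_map Z euclideanreal (g s)"
  shows "continuous_map Z (payoff_space E) (\<lambda>z. \<lambda>s\<in>states E. g s z)"
proof -
  let ?S = "states E" and ?h = "\<lambda>z. \<lambda>s\<in>states E. g s z"
  have mem: "?h z \<in> mspace (funspace ?S euclidean_metric)" for z
    using topspace_payoff_space[OF fin] by (auto simp: payoff_space_def)
  show ?thesis
    unfolding payoff_space_def mtopology_of_def
  proof (subst Metric_space.continuous_map_to_metric[OF Metric_space_mspace_mdist],
      intro ballI allI impI)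
    fix z and e :: real assume z: "z \<in> topspace Z" and e: "0 < e"
    \<comment> \<open>The radius \<open>e/2\<close> leaves room: a supremum of distances below
      \<open>e/2\<close> is only known to be at most \<open>e/2\<close>, while the target ball is
      open.\<close>
    define N where "N = (\<Inter>s\<in>?S. {w \<in> topspace Z. g s w \<in> ball (g s z) (e/2)})"
    have "openin Z N"
      unfolding N_def using fin ne g
      by (intro openin_INT2 ballI openin_continuous_map_preimage[where Y = euclideanreal]) auto
    moreover have "z \<in> N"
      using z e by (auto simp: N_def)
    moreover have "?h w \<in> Metric_space.mball (mspace (funspace ?S euclidean_metric))
        (mdist (funspace ?S euclidean_metric)) (?h z) e" if w: "w \<in> N" for w
    proof -
      \<comment> \<open>The function-space metric is this supremum between members and over a
        nonempty domain, which \<open>mem\<close> and \<open>ne\<close> supply.\<close>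
      have "mdist (funspace ?S euclidean_metric) (?h z) (?h w) = (SUP s\<in>?S. dist (?h z s) (?h w s))"
        using ne mem[of z] mem[of w]
        by (simp only: Metric_space.fdist_def[OF Met_TC.Metric_space_axioms] mdist_funspace
            mspace_funspace mdist_euclidean_metric mspace_euclidean_metric if_True simp_thms)
      also have "\<dots> \<le> e/2"
        using ne w by (intro cSUP_least) (auto simp: N_def intro: less_imp_le)
      finally have "mdist (funspace ?S euclidean_metric) (?h z) (?h w) \<le> e/2" .
      then show ?thesis
        unfolding Metric_space.in_mball[OF Metric_space_mspace_mdist]
        using e mem[of z] mem[of w] by linarith
    qed
    ultimately show "\<exists>N. openin Z N \<and> z \<in> N \<and> (\<forall>w\<in>N. ?h w \<in> Metric_space.mball
        (mspace (funspace ?S euclidean_metric)) (mdist (funspace ?S euclidean_metric)) (?h z) e)"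
      by blast
  qed
qed

section \<open>The dynamic program on PA states and its Bellman objective\<close>

locale pa_decision_problem =
  fixes E :: "'s primitives"
    and X :: "('x, 's) pa_system"
    and V :: "('x, 's) pa_structure"
    and B :: "nat \<Rightarrow> 'x \<Rightarrow> real set"
  assumes primitives: "primitives_ok E"
    and pa_system: "pa_state_system E X"
    and pa_structure: "pa_recursive_structure E X V"
    and regular: "dp_regularity E X B"
begin

text \<open>The continuation value \<open>j\<close> is a parameter, so that one objective serves
  policy utilities, Bellman values and the value function. The second branch is for the last
  consumption date.\<close>

definition bellman_obj :: "('x \<Rightarrow> real) \<Rightarrow> nat \<Rightarrow> 'x \<Rightarrow> real \<Rightarrow> real" where
  "bellman_obj j t x c =
     (if t < horizon E
      then aggregator V t x c (cert_equiv V t x (\<lambda>s\<in>states E. j (pa_trans X t x c s)))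
      else j (pa_trans X t x c (terminal E)))"

text \<open>The first argument counts the remaining consumption dates.\<close>

primrec bellman_aux :: "nat \<Rightarrow> 'x \<Rightarrow> real" where
  "bellman_aux 0 x = pa_end V x"
| "bellman_aux (Suc n) x =
     (SUP c\<in>B (horizon E - n) x. bellman_obj (bellman_aux n) (horizon E - n) x c)"

text \<open>Converts remaining dates to calendar dates; at \<open>Suc (horizon E)\<close> none
  remain.\<close>

definition bellman :: "nat \<Rightarrow> 'x \<Rightarrow> real" where
  "bellman t = bellman_aux (Suc (horizon E) - t)"

lemma bellman_terminal: "bellman (Suc (horizon E)) = pa_end V"
  by (auto simp: bellman_def)

lemma bellman_rec:
  "t \<le> horizon E \<Longrightarrow> bellman t x = (SUP c\<in>B t x. bellman_obj (bellman (Suc t)) t x c)"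
  by (simp add: bellman_def Suc_diff_le)

lemma policy_util_terminal: "policy_util E X V \<pi> (Suc (horizon E)) = pa_end V"
  by (rule ext, subst policy_util.simps) (simp add: generated_def)

lemma policy_util_rec:
  "t \<le> horizon E \<Longrightarrow>
   policy_util E X V \<pi> t x = bellman_obj (policy_util E X V \<pi> (Suc t)) t x (\<pi> t x)"
  by (subst policy_util.simps) (auto simp: bellman_obj_def)

lemma pa_trans_in_pa_set:
  assumes "t \<le> horizon E" "x \<in> pa_set X t" "c \<in> cons_set E" "s \<in> state_set E (Suc t)"
  shows "pa_trans X t x c s \<in> pa_set X (Suc t)"
proof -
  have "continuous_map
          (prod_topology (pa_space X t) (prod_topology (cons_space E) (state_space E (Suc t))))
          (pa_space X (Suc t)) (\<lambda>(x, c, s). pa_trans X t x c s)"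
    using pa_system assms(1) by (simp add: pa_state_system_def)
  from continuous_map_image_subset_topspace[OF this] show ?thesis
    using assms by (force simp: image_subset_iff)
qed

lemma continuous_map_pa_trans:
  assumes "t \<le> horizon E" "s \<in> state_set E (Suc t)"
  shows "continuous_map (prod_topology (pa_space X t) (cons_space E)) (pa_space X (Suc t))
           (\<lambda>p. pa_trans X t (fst p) (snd p) s)"
proof -
  have *: "continuous_map
          (prod_topology (pa_space X t) (prod_topology (cons_space E) (state_space E (Suc t))))
          (pa_space X (Suc t)) (\<lambda>(x, c, s). pa_trans X t x c s)"
    using pa_system assms(1) by (simp add: pa_state_system_def)
  have "continuous_map (prod_topology (pa_space X t) (cons_space E))
          (prod_topology (pa_space X t) (prod_topology (cons_space E) (state_space E (Suc t))))
          (\<lambda>p. (fst p, snd p, s))"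
    using assms(2) by (intro continuous_map_pairedI continuous_map_fst continuous_map_snd) simp
  from continuous_map_compose[OF this *] show ?thesis
    by (simp add: o_def)
qed

text \<open>Transitions land in \<open>pa_set X (Suc t)\<close>, so comparing continuations there
  suffices. Before the horizon the inequality passes through the certainty equivalent and then the
  aggregator, both monotone.\<close>

lemma bellman_obj_mono:
  assumes t: "t \<le> horizon E" and x: "x \<in> pa_set X t" and c: "c \<in> cons_set E"
    and le: "\<And>y. y \<in> pa_set X (Suc t) \<Longrightarrow> j y \<le> k y"
  shows "bellman_obj j t x c \<le> bellman_obj k t x c"
proof (cases "t < horizon E")
  case True
  let ?j = "\<lambda>s\<in>states E. j (pa_trans X t x c s)"
  let ?k = "\<lambda>s\<in>states E. k (pa_trans X t x c s)"
  have fin: "finite (states E)"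
    using primitives by (simp add: primitives_ok_def)
  have "\<forall>s\<in>states E. ?j s \<le> ?k s"
    using True by (auto simp: state_set_def intro!: le pa_trans_in_pa_set[OF t x c])
  moreover have "?j \<in> topspace (payoff_space E)" "?k \<in> topspace (payoff_space E)"
    by (auto simp: topspace_payoff_space[OF fin])
  ultimately have "cert_equiv V t x ?j \<le> cert_equiv V t x ?k"
    using pa_structure True x unfolding pa_recursive_structure_def by blast
  moreover have "mono (aggregator V t x c)"
    using pa_structure True x c unfolding pa_recursive_structure_def by blast
  ultimately show ?thesis
    using True by (simp add: bellman_obj_def monoD)
next
  case False
  \<comment> \<open>Here \<open>t = horizon E\<close>, so \<open>Suc t\<close> lies past the horizon
    and \<open>terminal E\<close> is its only state.\<close>
  with t have "terminal E \<in> state_set E (Suc t)"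
    by (simp add: state_set_def)
  from le[OF pa_trans_in_pa_set[OF t x c this]] False show ?thesis
    by (simp add: bellman_obj_def)
qed

lemma bellman_obj_cong:
  assumes "t \<le> horizon E" "x \<in> pa_set X t" "c \<in> cons_set E"
    and "\<And>y. y \<in> pa_set X (Suc t) \<Longrightarrow> j y = k y"
  shows "bellman_obj j t x c = bellman_obj k t x c"
  using assms by (intro antisym bellman_obj_mono) auto

text \<open>The objective is a composition of transition, continuation value, certainty equivalent
  and aggregator; the payoff vector in the middle is continuous because each of its finitely many
  coordinates is.\<close>

lemma continuous_map_bellman_obj:
  assumes t: "t \<le> horizon E" and j: "continuous_map (pa_space X (Suc t)) euclideanreal j"
  shows "continuous_map (prod_topology (pa_space X t) (cons_space E)) euclideanreal
           (\<lambda>(x, c). bellman_obj j t x c)"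
proof -
  let ?Z = "prod_topology (pa_space X t) (cons_space E)"
  have jt: "continuous_map ?Z euclideanreal (\<lambda>p. j (pa_trans X t (fst p) (snd p) s))"
    if "s \<in> state_set E (Suc t)" for s
    using continuous_map_compose[OF continuous_map_pa_trans[OF t that] j] by (simp add: o_def)
  show ?thesis
  proof (cases "t < horizon E")
    case True
    define m where
      "m p = cert_equiv V t (fst p) (\<lambda>s\<in>states E. j (pa_trans X t (fst p) (snd p) s))" for p
    have W: "continuous_map
          (prod_topology (pa_space X t) (prod_topology (cons_space E) euclideanreal)) euclideanreal
          (\<lambda>(x, c, v). aggregator V t x c v)"
      and M: "continuous_map (prod_topology (pa_space X t) (payoff_space E)) euclideanreal
          (\<lambda>(x, u). cert_equiv V t x u)"
      using pa_structure True unfolding pa_recursive_structure_def by blast+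
    have "continuous_map ?Z (payoff_space E)
            (\<lambda>p. \<lambda>s\<in>states E. j (pa_trans X t (fst p) (snd p) s))"
      using primitives True
      by (intro continuous_map_payoff_space jt) (auto simp: primitives_ok_def state_set_def)
    then have "continuous_map ?Z (prod_topology (pa_space X t) (payoff_space E))
        (\<lambda>p. (fst p, \<lambda>s\<in>states E. j (pa_trans X t (fst p) (snd p) s)))"
      by (intro continuous_map_pairedI continuous_map_fst)
    from continuous_map_compose[OF this M] have "continuous_map ?Z euclideanreal m"
      by (simp add: o_def m_def[abs_def])
    then have "continuous_map ?Z
        (prod_topology (pa_space X t) (prod_topology (cons_space E) euclideanreal))
        (\<lambda>p. (fst p, snd p, m p))"
      by (intro continuous_map_pairedI continuous_map_fst continuous_map_snd)
    from continuous_map_compose[OF this W] True show ?thesis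
      by (simp add: o_def m_def[abs_def] bellman_obj_def split_def)
  next
    case False
    with t jt[of "terminal E"] show ?thesis
      by (simp add: bellman_obj_def split_def state_set_def)
  qed
qed

section \<open>Attainment and continuity of the Bellman values\<close>

lemma feasible_subset: "t \<le> horizon E \<Longrightarrow> x \<in> pa_set X t \<Longrightarrow> B t x \<subseteq> cons_set E"
  using regular by (fastforce simp: dp_regularity_def upper_hemicontinuous_map_def)

lemma compactin_feasible:
  "t \<le> horizon E \<Longrightarrow> x \<in> pa_set X t \<Longrightarrow> compactin (cons_space E) (B t x)"
  using regular feasible_subset[of t x] by (simp add: dp_regularity_def compactin_subtopology)

lemma bellman_obj_attains_max:
  assumes t: "t \<le> horizon E" and x: "x \<in> pa_set X t"
    and j: "continuous_map (pa_space X (Suc t)) euclideanreal j"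
  obtains c where "c \<in> B t x" "\<And>c'. c' \<in> B t x \<Longrightarrow> bellman_obj j t x c' \<le> bellman_obj j t x c"
proof (rule attains_max_on_compact[OF compactin_feasible[OF t x]])
  show "B t x \<noteq> {}"
    using regular t x by (simp add: dp_regularity_def)
  \<comment> \<open>Fixing \<open>x\<close> embeds the consumption interval as a slice of the
    product, so joint continuity gives continuity in \<open>c\<close> alone.\<close>
  have "continuous_map (cons_space E) (prod_topology (pa_space X t) (cons_space E)) (\<lambda>c. (x, c))"
    using x by (intro continuous_map_pairedI) auto
  from continuous_map_compose[OF this continuous_map_bellman_obj[OF t j]]
  show "continuous_map (cons_space E) euclideanreal (bellman_obj j t x)"
    by (simp add: o_def)
qed (use that in blast)

text \<open>Attainment turns the real supremum used in \<open>bellman_aux\<close> into a genuine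
  maximum.\<close>

lemma is_maximum_SUP_bellman_obj:
  assumes t: "t \<le> horizon E" and x: "x \<in> pa_set X t"
    and j: "continuous_map (pa_space X (Suc t)) euclideanreal j"
  shows "is_maximum (SUP c\<in>B t x. bellman_obj j t x c) (bellman_obj j t x ` B t x)"
proof -
  obtain c where c: "c \<in> B t x"
    "\<And>c'. c' \<in> B t x \<Longrightarrow> bellman_obj j t x c' \<le> bellman_obj j t x c"
    using bellman_obj_attains_max[OF assms] by blast
  then have "(SUP c\<in>B t x. bellman_obj j t x c) = bellman_obj j t x c"
    by (intro cSup_eq_maximum) auto
  with c show ?thesis
    by (auto simp: is_maximum_def)
qed

text \<open>Attainment at date \<open>t\<close> rests on continuity of the value at
  \<open>Suc t\<close>, so continuity is carried by a downward induction from
  \<open>Suc (horizon E)\<close>, with Berge's theorem as its step.\<close>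

lemma continuous_map_bellman:
  assumes "t \<le> Suc (horizon E)"
  shows "continuous_map (pa_space X t) euclideanreal (bellman t)"
  using assms
proof (induction rule: inc_induct)
  case base
  show ?case
    using pa_structure by (simp add: bellman_terminal pa_recursive_structure_def)
next
  case (step t)
  then have t: "t \<le> horizon E" by simp
  show ?case
  proof (rule Berge_maximum[OF continuous_map_bellman_obj[OF t step.IH]])
    show "is_maximum (bellman t x) (bellman_obj (bellman (Suc t)) t x ` B t x)"
      if "x \<in> pa_set X t" for x
      using is_maximum_SUP_bellman_obj[OF t that step.IH] by (simp add: bellman_rec[OF t])
  qed (use regular t compactin_feasible in \<open>auto simp: dp_regularity_def\<close>)
qed

lemma is_maximum_bellman:
  assumes t: "t \<le> horizon E" and x: "x \<in> pa_set X t"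
  shows "is_maximum (bellman t x) (bellman_obj (bellman (Suc t)) t x ` B t x)"
  using is_maximum_SUP_bellman_obj[OF t x continuous_map_bellman] t by (simp add: bellman_rec[OF t])

section \<open>Policy utilities, greedy policies and the value function\<close>

lemma policy_util_le_bellman:
  assumes \<pi>: "\<pi> \<in> policies E X B" and "t \<le> Suc (horizon E)" "x \<in> pa_set X t"
  shows "policy_util E X V \<pi> t x \<le> bellman t x"
  using assms(2,3)
proof (induction arbitrary: x rule: inc_induct)
  case base
  show ?case
    by (simp add: bellman_terminal policy_util_terminal)
next
  case (step t)
  then have t: "t \<le> horizon E" by simp
  have feas: "\<pi> t x \<in> B t x"
    using \<pi> t step.prems by (simp add: policies_def)
  \<comment> \<open>Monotonicity lets the induction hypothesis replace the policy's continuation by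
    the Bellman one; maximality over \<open>B t x\<close> then dominates the choice
    \<open>\<pi> t x\<close>.\<close>
  have "policy_util E X V \<pi> t x \<le> bellman_obj (bellman (Suc t)) t x (\<pi> t x)"
    unfolding policy_util_rec[OF t]
    using feas feasible_subset[OF t step.prems] step.IH step.prems
    by (intro bellman_obj_mono[OF t]) auto
  also have "\<dots> \<le> bellman t x"
    using is_maximum_bellman[OF t step.prems] feas by (auto simp: is_maximum_def)
  finally show ?case .
qed

text \<open>Both sides become the objective at the same consumption \<open>\<pi> t x\<close>, so
  only continuations remain to be compared, and these agree by downward induction.\<close>

lemma greedy_policy_util:
  assumes \<pi>: "\<pi> \<in> policies E X B"
    and greedy: "\<And>t x. t \<le> horizon E \<Longrightarrow> x \<in> pa_set X t \<Longrightarrow>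
      bellman_obj (bellman (Suc t)) t x (\<pi> t x) = bellman t x"
    and "t \<le> Suc (horizon E)" "x \<in> pa_set X t"
  shows "policy_util E X V \<pi> t x = bellman t x"
  using assms(3,4)
proof (induction arbitrary: x rule: inc_induct)
  case base
  show ?case
    by (simp add: bellman_terminal policy_util_terminal)
next
  case (step t)
  then have t: "t \<le> horizon E" by simp
  have "\<pi> t x \<in> cons_set E"
    using \<pi> t step.prems feasible_subset[OF t step.prems] by (auto simp: policies_def)
  then show ?case
    unfolding policy_util_rec[OF t] greedy[OF t step.prems, symmetric]
    by (intro bellman_obj_cong[OF t step.prems] step.IH)
qed

lemma greedy_policy_exists:
  "\<exists>\<pi>\<in>policies E X B. \<forall>t\<le>horizon E. \<forall>x\<in>pa_set X t.
     bellman_obj (bellman (Suc t)) t x (\<pi> t x) = bellman t x"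
proof -
  have "\<exists>c. c \<in> B t x \<and> bellman_obj (bellman (Suc t)) t x c = bellman t x"
    if "t \<le> horizon E" "x \<in> pa_set X t" for t x
    using is_maximum_bellman[OF that] by (auto simp: is_maximum_def)
  \<comment> \<open>Policies are arbitrary selections, so choosing a maximizer at each date and
    state independently is enough.\<close>
  then obtain \<pi> where "\<And>t x. t \<le> horizon E \<Longrightarrow> x \<in> pa_set X t \<Longrightarrow>
      \<pi> t x \<in> B t x \<and> bellman_obj (bellman (Suc t)) t x (\<pi> t x) = bellman t x"
    by metis
  then show ?thesis
    by (intro bexI[of _ \<pi>]) (auto simp: policies_def)
qed

text \<open>The real \<open>SUP\<close> in \<open>value_fun\<close> is a least upper bound only if
  the family is bounded above; the Bellman value is such a bound.\<close>

lemma bdd_above_policy_utils: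
  assumes "t \<le> horizon E" "x \<in> pa_set X t"
  shows "bdd_above ((\<lambda>\<pi>. policy_util E X V \<pi> t x) ` policies E X B)"
  using policy_util_le_bellman[of _ t x] assms by (intro bdd_aboveI2[where M = "bellman t x"]) auto

text \<open>The Bellman value bounds all policy utilities and a greedy policy reaches it. Date
  \<open>Suc (horizon E)\<close> is included because the objective at the last consumption date
  evaluates its continuation there.\<close>

lemma value_fun_eq_bellman:
  assumes "t \<le> Suc (horizon E)" "x \<in> pa_set X t"
  shows "value_fun E X V B t x = bellman t x"
proof -
  obtain \<pi> where "\<pi> \<in> policies E X B" "policy_util E X V \<pi> t x = bellman t x"
    using greedy_policy_exists greedy_policy_util[OF _ _ assms] by blast
  then show ?thesis
    unfolding value_fun_def using policy_util_le_bellman assms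
    by (intro cSup_eq_maximum) (auto intro: rev_image_eqI)
qed

lemma bellman_obj_value_fun:
  assumes "t \<le> horizon E" "x \<in> pa_set X t" "c \<in> B t x"
  shows "bellman_obj (value_fun E X V B (Suc t)) t x c = bellman_obj (bellman (Suc t)) t x c"
  using assms feasible_subset[OF assms(1,2)]
  by (intro bellman_obj_cong value_fun_eq_bellman) auto

lemma is_maximum_value_fun:
  assumes "t \<le> horizon E" "x \<in> pa_set X t"
  shows "is_maximum (value_fun E X V B t x) (bellman_obj (value_fun E X V B (Suc t)) t x ` B t x)"
  using is_maximum_bellman[OF assms] bellman_obj_value_fun[OF assms] assms
  by (simp add: value_fun_eq_bellman cong: image_cong_simp)

lemma continuous_map_value_fun:
  assumes "t \<le> horizon E"
  shows "continuous_map (pa_space X t) euclideanreal (value_fun E X V B t)"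
  using continuous_map_bellman[of t] assms
  by (auto intro: continuous_map_eq simp: value_fun_eq_bellman)

text \<open>One greedy policy, fixed before date and state, yields both claims: its choices reach
  the maximum of the objective, and its utility is the Bellman value, hence the value
  function.\<close>

lemma optimal_policy_exists:
  "\<exists>\<pi>\<in>policies E X B. \<forall>t\<le>horizon E. \<forall>x\<in>pa_set X t.
     is_arg_max (bellman_obj (value_fun E X V B (Suc t)) t x) (\<lambda>c. c \<in> B t x) (\<pi> t x) \<and>
     policy_util E X V \<pi> t x = value_fun E X V B t x"
proof -
  obtain \<pi> where \<pi>: "\<pi> \<in> policies E X B"
    and greedy: "\<And>t x. t \<le> horizon E \<Longrightarrow> x \<in> pa_set X t \<Longrightarrow>
      bellman_obj (bellman (Suc t)) t x (\<pi> t x) = bellman t x"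
    using greedy_policy_exists by blast
  show ?thesis
  proof (intro bexI[OF _ \<pi>] allI impI ballI conjI)
    fix t x assume t: "t \<le> horizon E" and x: "x \<in> pa_set X t"
    show "policy_util E X V \<pi> t x = value_fun E X V B t x"
      using greedy_policy_util[OF \<pi> greedy] t x by (simp add: value_fun_eq_bellman)
    have feas: "\<pi> t x \<in> B t x"
      using \<pi> t x by (simp add: policies_def)
    have "bellman_obj (value_fun E X V B (Suc t)) t x (\<pi> t x) = value_fun E X V B t x"
      using bellman_obj_value_fun[OF t x feas] greedy[OF t x] t x
      by (simp add: value_fun_eq_bellman)
    then show "is_arg_max (bellman_obj (value_fun E X V B (Suc t)) t x) (\<lambda>c. c \<in> B t x) (\<pi> t x)"
      using is_maximum_value_fun[OF t x] feas by (auto simp: is_arg_max_linorder is_maximum_def)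
  qed
qed

lemma bellman_obj_value_fun_terminal:
  assumes "x \<in> pa_set X (horizon E)" "c \<in> B (horizon E) x"
  shows "bellman_obj (value_fun E X V B (Suc (horizon E))) (horizon E) x c =
    util_end (generated E X V) (pa_trans X (horizon E) x c (terminal E))"
  using bellman_obj_value_fun[OF order_refl assms]
  by (simp add: bellman_terminal bellman_obj_def generated_def)

end

section \<open>Optimality for the feasibility induced by the summary maps\<close>

theorem theorem5p4:
  fixes E :: "'s primitives"
    and P :: "'s preference"
    and U :: "('s history, 's) utilities"
    and X :: "('x, 's) pa_system"
    and V :: "('x, 's) pa_structure"
    and \<sigma> :: "nat \<Rightarrow> 's history \<Rightarrow> 'x"
    and A :: "nat \<Rightarrow> 's history \<Rightarrow> real set"
  assumes "primitives_ok E"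
    and "grand_preference E P"
    and "utility_system E U"
    and "compatible E U P"
    and "pa_state_system E X"
    and "pa_recursive_structure E X V"
    and "factorizes E X V \<sigma> U"
    and "\<And>t. t \<le> Suc (horizon E) \<Longrightarrow> \<sigma> t ` hist_set E t = pa_set X t"
    and "feasibility_correspondence E A"
    and "markov_feasibility E \<sigma> A"
    and "dp_regularity E X (pa_feasible E \<sigma> A)"
  shows "let T = horizon E;
             B = pa_feasible E \<sigma> A;
             J = value_fun E X V B;
             objT = (\<lambda>x c. util_end (generated E X V) (pa_trans X T x c (terminal E)));
             obj = (\<lambda>t x c. aggregator V t x c
                      (cert_equiv V t x (\<lambda>s\<in>states E. J (Suc t) (pa_trans X t x c s))))
         in
           (\<forall>t\<le>T. \<forall>x\<in>pa_set X t.
              bdd_above ((\<lambda>\<pi>. policy_util E X V \<pi> t x) ` policies E X B)) \<and>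
           (\<forall>x\<in>pa_set X T. is_maximum (J T x) (objT x ` B T x)) \<and>
           (\<forall>t<T. \<forall>x\<in>pa_set X t. is_maximum (J t x) (obj t x ` B t x)) \<and>
           (\<exists>\<pi>\<in>policies E X B.
              (\<forall>x\<in>pa_set X T. is_arg_max (objT x) (\<lambda>c. c \<in> B T x) (\<pi> T x)) \<and>
              (\<forall>t<T. \<forall>x\<in>pa_set X t. is_arg_max (obj t x) (\<lambda>c. c \<in> B t x) (\<pi> t x)) \<and>
              (\<forall>t\<le>T. \<forall>x\<in>pa_set X t. policy_util E X V \<pi> t x = J t x)) \<and>
           (\<forall>t\<le>T. continuous_map (pa_space X t) euclideanreal (J t))"
proof -
  define B where "B = pa_feasible E \<sigma> A"
  interpret pa_decision_problem E X V B
    using assms by unfold_locales (auto simp: B_def)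
  let ?T = "horizon E" and ?J = "value_fun E X V B"
  let ?objT = "\<lambda>x c. util_end (generated E X V) (pa_trans X ?T x c (terminal E))"
  let ?obj = "\<lambda>t x c. aggregator V t x c
    (cert_equiv V t x (\<lambda>s\<in>states E. ?J (Suc t) (pa_trans X t x c s)))"
  \<comment> \<open>Before the horizon the two objectives agree as functions. At the horizon
    \<open>bellman_obj_value_fun_terminal\<close> equates them on feasible consumption, which is
    enough for the image and the maximizers.\<close>
  have obj: "bellman_obj (?J (Suc t)) t x = ?obj t x" if "t < ?T" for t x
    using that by (simp add: bellman_obj_def fun_eq_iff)
  obtain \<pi> where \<pi>: "\<pi> \<in> policies E X B"
    and arg_max: "\<And>t x. t \<le> ?T \<Longrightarrow> x \<in> pa_set X t \<Longrightarrow>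
      is_arg_max (bellman_obj (?J (Suc t)) t x) (\<lambda>c. c \<in> B t x) (\<pi> t x)"
    and util: "\<And>t x. t \<le> ?T \<Longrightarrow> x \<in> pa_set X t \<Longrightarrow> policy_util E X V \<pi> t x = ?J t x"
    using optimal_policy_exists by blast
  have "is_maximum (?J ?T x) (?objT x ` B ?T x)" if "x \<in> pa_set X ?T" for x
    using is_maximum_value_fun[OF order_refl that] bellman_obj_value_fun_terminal[OF that]
    by (simp cong: image_cong_simp)
  moreover have "is_maximum (?J t x) (?obj t x ` B t x)" if "t < ?T" "x \<in> pa_set X t" for t x
    using is_maximum_value_fun[of t x] that by (simp add: obj)
  moreover have "is_arg_max (?objT x) (\<lambda>c. c \<in> B ?T x) (\<pi> ?T x)" if "x \<in> pa_set X ?T" for x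
    using arg_max[OF order_refl that] bellman_obj_value_fun_terminal[OF that]
    by (auto simp: is_arg_max_linorder)
  moreover have "is_arg_max (?obj t x) (\<lambda>c. c \<in> B t x) (\<pi> t x)"
    if "t < ?T" "x \<in> pa_set X t" for t x
    using arg_max[of t x] that by (simp add: obj)
  ultimately show ?thesis
    unfolding Let_def B_def[symmetric]
    by (intro conjI bexI[OF _ \<pi>] allI ballI impI)
      (simp_all only: bdd_above_policy_utils continuous_map_value_fun util)
qed

end
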